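(* Consider $j\ge 1$ steps of the inexact explicit external deflation (EED) procedure for a real symmetric matrix $A\in\mathbb{R}^{n\times n}$: real shifts $\sigma_1,\ldots,\sigma_j$, real numbers $\widehat{\lambda}_1,\ldots,\widehat{\lambda}_{j+1}$, unit vectors $\widehat{v}_1,\ldots,\widehat{v}_{j+1}\in\mathbb{R}^n$ and residual vectors $\eta_1,\ldots,\eta_{j+1}\in\mathbb{R}^n$ with $$\Big(A+\sum_{k=1}^{i}\sigma_k\widehat{v}_k\widehat{v}_k^{\mathrm T}\Big)\widehat{v}_{i+1}=\widehat{\lambda}_{i+1}\widehat{v}_{i+1}+\eta_{i+1},\qquad i=0,1,\ldots,j,$$ and with spectral gap $\gamma_j>0$. If $\tau_j\,\omega_j<\sqrt{2}$ and $\omega_{j+1}<1$, then the symmetric backward error norm $\delta_{j+1}$ of the computed eigenpairs $(\widehat{\Lambda}_{j+1},\widehat{V}_{j+1})$ of $A$ satisfies $$\delta_{j+1}\le\sqrt{2}\left(\frac{1+c_j\tau_j(1+\omega_{j+1})}{\sqrt{1-\omega_{j+1}}}\right)\|E_{j+1}\|_{\mathrm F},$$ where $c_j=(1-\tau_j\omega_j/\sqrt{2})^{-1}$.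
   Context: Notation: $\widehat{V}_i=[\widehat{v}_1,\ldots,\widehat{v}_i]$ and $E_i=[\eta_1,\ldots,\eta_i]$ are $n\times i$ matrices, and $\widehat{\Lambda}_i=\mathrm{diag}(\widehat{\lambda}_1,\ldots,\widehat{\lambda}_i)$, for $1\le i\le j+1$. $\|\cdot\|_{\mathrm F}$ is the Frobenius norm; unit vector means Euclidean norm $1$. Loss of orthogonality: $\omega_i=\|\widehat{V}_i^{\mathrm T}\widehat{V}_i-I_i\|_{\mathrm F}$. Spectral gap: $\gamma_j=\min\{|\lambda-\theta| : \lambda\in\{\widehat{\lambda}_1,\ldots,\widehat{\lambda}_{j+1}\},\ \theta\in\{\widehat{\lambda}_1+\sigma_1,\ldots,\widehat{\lambda}_j+\sigma_j\}\}$, assumed positive. Shift-gap ratio: $\tau_j=\frac{1}{\gamma_j}\max_{1\le i\le j}|\sigma_i|$. Symmetric backward error norm: let $Q_{j+1}$ be the orthonormal factor from the polar decomposition $\widehat{V}_{j+1}=Q_{j+1}P_{j+1}$, i.e. $Q_{j+1}^{\mathrm T}Q_{j+1}=I_{j+1}$ and $P_{j+1}$ is symmetric positive semidefinite. Then $$\delta_{j+1}=\min\{\|\Delta\|_{\mathrm F} : \Delta=\Delta^{\mathrm T}\in\mathbb{R}^{n\times n},\ (A+\Delta)Q_{j+1}=Q_{j+1}\widehat{\Lambda}_{j+1}\}.$$ *)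

theory Defs
  imports Complex_Main "Jordan_Normal_Form.Matrix"
begin

text \<open>
  The families of shifts, eigenvalues, vectors and residuals are functions on \<^typ>\<open>nat\<close> that are
  only ever used at the indices 1, 2, ..., as in the usual mathematical notation; the indices of
  \<^typ>\<open>real mat\<close> and \<^typ>\<open>real vec\<close> start at 0.
\<close>

definition vec_norm2 :: "real vec \<Rightarrow> real" where
  "vec_norm2 x = sqrt (\<Sum>r<dim_vec x. (x $ r)\<^sup>2)"

definition frob_norm :: "real mat \<Rightarrow> real" where
  "frob_norm M = sqrt (\<Sum>r<dim_row M. \<Sum>c<dim_col M. (M $$ (r, c))\<^sup>2)"

definition symmetric_mat :: "real mat \<Rightarrow> bool" where
  "symmetric_mat M \<longleftrightarrow> M\<^sup>T = M"

definition psd_mat :: "real mat \<Rightarrow> bool" where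
  "psd_mat M \<longleftrightarrow> symmetric_mat M \<and> (\<forall>x \<in> carrier_vec (dim_row M). 0 \<le> x \<bullet> (M *\<^sub>v x))"

definition outer_prod :: "real vec \<Rightarrow> real vec \<Rightarrow> real mat" where
  "outer_prod x y = mat (dim_vec x) (dim_vec y) (\<lambda>(r, c). x $ r * y $ c)"

text \<open>The matrix \<open>A + (\<Sum>k=1..i. \<sigma> k v k (v k)\<^sup>T)\<close>; the sum is taken entrywise because
  \<^typ>\<open>real mat\<close>, having no zero element common to all dimensions, does not admit \<^const>\<open>sum\<close>.\<close>

definition deflated :: "real mat \<Rightarrow> (nat \<Rightarrow> real) \<Rightarrow> (nat \<Rightarrow> real vec) \<Rightarrow> nat \<Rightarrow> real mat" where
  "deflated A \<sigma> v i =
     A + mat (dim_row A) (dim_col A)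
           (\<lambda>(r, c). \<Sum>k=1..i. (\<sigma> k \<cdot>\<^sub>m outer_prod (v k) (v k)) $$ (r, c))"

definition cols_mat :: "nat \<Rightarrow> (nat \<Rightarrow> real vec) \<Rightarrow> nat \<Rightarrow> real mat" where
  "cols_mat n v i = mat_of_cols n (map v [1..<i+1])"

definition eigval_mat :: "(nat \<Rightarrow> real) \<Rightarrow> nat \<Rightarrow> real mat" where
  "eigval_mat lam i = mat_diag i (\<lambda>k. lam (k + 1))"

definition orth_loss :: "nat \<Rightarrow> (nat \<Rightarrow> real vec) \<Rightarrow> nat \<Rightarrow> real" where
  "orth_loss n v i = frob_norm ((cols_mat n v i)\<^sup>T * cols_mat n v i - 1\<^sub>m i)"

definition spectral_gap :: "(nat \<Rightarrow> real) \<Rightarrow> (nat \<Rightarrow> real) \<Rightarrow> nat \<Rightarrow> real" where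
  "spectral_gap lam \<sigma> j =
     Min {\<bar>x - \<theta>\<bar> | x \<theta>. x \<in> lam ` {1..j+1} \<and> \<theta> \<in> (\<lambda>i. lam i + \<sigma> i) ` {1..j}}"

definition shift_gap_ratio :: "(nat \<Rightarrow> real) \<Rightarrow> (nat \<Rightarrow> real) \<Rightarrow> nat \<Rightarrow> real" where
  "shift_gap_ratio lam \<sigma> j = 1 / spectral_gap lam \<sigma> j * Max ((\<lambda>i. \<bar>\<sigma> i\<bar>) ` {1..j})"

definition polar_decomposition :: "real mat \<Rightarrow> real mat \<Rightarrow> real mat \<Rightarrow> bool" where
  "polar_decomposition M Q P \<longleftrightarrow>
     Q \<in> carrier_mat (dim_row M) (dim_col M) \<and> P \<in> carrier_mat (dim_col M) (dim_col M) \<and>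
     M = Q * P \<and> Q\<^sup>T * Q = 1\<^sub>m (dim_col M) \<and> psd_mat P"

text \<open>\<open>LEAST\<close> is the minimum of the set of admissible norms. The minimum is attained whenever
  \<open>Q\<close> has orthonormal columns and \<open>A\<close> and \<open>L\<close> are symmetric: with \<open>R = Q L - A Q\<close>, at the
  perturbation \<open>R Q\<^sup>T + Q R\<^sup>T - Q (Q\<^sup>T R) Q\<^sup>T\<close>.\<close>

definition sym_backward_error :: "real mat \<Rightarrow> real mat \<Rightarrow> real mat \<Rightarrow> real" where
  "sym_backward_error A Q L =
     (LEAST d. \<exists>D \<in> carrier_mat (dim_row A) (dim_row A).
        symmetric_mat D \<and> (A + D) * Q = Q * L \<and> d = frob_norm D)"

end

theory Submission
  imports Defs "HOL-Analysis.L2_Norm" "Jordan_Normal_Form.Determinant"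
begin

text \<open>
  Write \<open>V = Q P\<close> and \<open>\<Phi>\<close> for the strictly upper triangular part of \<open>V\<^sup>T V\<close> with row \<open>i\<close> scaled by
  \<open>\<sigma>\<^sub>i\<close>; the deflation steps say \<open>A V + V \<Phi> = V \<Lambda> + E\<close>. With \<open>X = Q\<^sup>T A Q - \<Lambda>\<close> and
  \<open>Z = (I - Q Q\<^sup>T) A Q\<close> one has \<open>\<delta>\<^sup>2 = 2 \<parallel>Z\<parallel>\<^sup>2 + \<parallel>X\<parallel>\<^sup>2\<close>. Both \<open>\<parallel>Z\<parallel>\<close> and \<open>\<parallel>X\<parallel>\<close> are controlled by
  the corresponding components of \<open>E - V \<Phi>\<close> divided by \<open>\<mu> = sqrt (1 - \<omega>)\<close>, a lower bound for \<open>P\<close>.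
  Since \<open>V \<Phi>\<close> lies in the range of \<open>Q\<close>, it enters only through \<open>X\<close> and is not multiplied by
  \<open>sqrt 2\<close>, so that \<open>\<mu> \<delta> \<le> sqrt 2 \<parallel>E\<parallel> + \<parallel>P \<Phi>\<parallel>\<close>. Finally, the symmetry of \<open>V\<^sup>T A V\<close>
  expresses the off-diagonal entries of \<open>V\<^sup>T V\<close>, up to a factor bounded by the inverse gap, through
  \<open>V\<^sup>T E\<close> and a product of triangular matrices, whence
  \<open>\<parallel>\<Phi>\<parallel> \<le> c \<tau> sqrt 2 \<parallel>V\<^sup>T E\<parallel>\<close>.
\<close>

section \<open>The Frobenius inner product\<close>

text \<open>Cancels a norm \<open>a\<close> after Cauchy-Schwarz; for \<open>a = 0\<close> the claim
  reduces to \<open>0 \<le> b\<close>.\<close>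

lemma mult_le_if_mult_power2_le:
  fixes a b t :: real
  assumes "t * a\<^sup>2 \<le> b * a" "0 \<le> a" "0 \<le> b"
  shows "t * a \<le> b"
  using assms by (cases "a = 0") (auto simp: power2_eq_square simp flip: mult.assoc)

text \<open>The trace of \<open>M\<^sup>T * N\<close>. The summation ranges are read off
  \<open>M\<close> alone, so the rules below fix common dimensions.\<close>

definition frob_inner :: "real mat \<Rightarrow> real mat \<Rightarrow> real" where
  "frob_inner M N = (\<Sum>r<dim_row M. \<Sum>c<dim_col M. M $$ (r, c) * N $$ (r, c))"

lemma frob_norm_eq_L2_set:
  assumes "M \<in> carrier_mat m k"
  shows "frob_norm M = L2_set (($$) M) ({..<m} \<times> {..<k})"
  using assms by (simp add: frob_norm_def L2_set_def sum.cartesian_product)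

lemma frob_norm_nonneg [simp]: "0 \<le> frob_norm M"
  by (simp add: frob_norm_def sum_nonneg)

lemma frob_inner_self: "frob_inner M M = (frob_norm M)\<^sup>2"
  by (simp add: frob_norm_def frob_inner_def sum_nonneg power2_eq_square)

lemma frob_inner_commute:
  assumes "M \<in> carrier_mat m k" "N \<in> carrier_mat m k"
  shows "frob_inner M N = frob_inner N M"
  using assms by (simp add: frob_inner_def mult.commute)

lemma frob_inner_transpose:
  assumes "M \<in> carrier_mat m k" "N \<in> carrier_mat m k"
  shows "frob_inner M\<^sup>T N\<^sup>T = frob_inner M N"
  using assms by (simp add: frob_inner_def) (rule sum.swap)

lemma frob_norm_transpose: "frob_norm M\<^sup>T = frob_norm M"
proof -
  have "(frob_norm M\<^sup>T)\<^sup>2 = (frob_norm M)\<^sup>2"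
    using frob_inner_transpose[of M _ _ M] by (auto simp flip: frob_inner_self)
  then show ?thesis by simp
qed

lemma frob_norm_uminus:
  assumes "M \<in> carrier_mat m k"
  shows "frob_norm (- M) = frob_norm M"
  using assms by (simp add: frob_norm_def)

lemma frob_inner_add_right:
  assumes "L \<in> carrier_mat m k" "M \<in> carrier_mat m k" "N \<in> carrier_mat m k"
  shows "frob_inner L (M + N) = frob_inner L M + frob_inner L N"
  using assms by (simp add: frob_inner_def sum.distrib algebra_simps)

lemma frob_inner_minus_right:
  assumes "L \<in> carrier_mat m k" "M \<in> carrier_mat m k" "N \<in> carrier_mat m k"
  shows "frob_inner L (M - N) = frob_inner L M - frob_inner L N"
  using assms by (simp add: frob_inner_def sum_subtractf algebra_simps)

lemma frob_inner_smult_right: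
  assumes "L \<in> carrier_mat m k" "M \<in> carrier_mat m k"
  shows "frob_inner L (t \<cdot>\<^sub>m M) = t * frob_inner L M"
  using assms by (simp add: frob_inner_def sum_distrib_left algebra_simps)

lemma frob_inner_zero_right:
  assumes "M \<in> carrier_mat m k"
  shows "frob_inner M (0\<^sub>m m k) = 0"
  using assms by (simp add: frob_inner_def)

lemma frob_inner_uminus_left:
  assumes "L \<in> carrier_mat m k" "M \<in> carrier_mat m k"
  shows "frob_inner (- L) M = - frob_inner L M"
  using assms by (simp add: frob_inner_def sum_negf)

lemma frob_inner_add_left:
  assumes "L \<in> carrier_mat m k" "M \<in> carrier_mat m k" "N \<in> carrier_mat m k"
  shows "frob_inner (L + M) N = frob_inner L N + frob_inner M N"
  using assms by (simp add: frob_inner_def sum.distrib algebra_simps)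

lemma frob_inner_minus_left:
  assumes "L \<in> carrier_mat m k" "M \<in> carrier_mat m k" "N \<in> carrier_mat m k"
  shows "frob_inner (L - M) N = frob_inner L N - frob_inner M N"
  using assms by (simp add: frob_inner_def sum_subtractf algebra_simps)

lemma mult_mat_index:
  assumes "A \<in> carrier_mat n m" "B \<in> carrier_mat m k" "r < n" "c < k"
  shows "(A * B) $$ (r, c) = (\<Sum>l<m. A $$ (r, l) * B $$ (l, c))"
  using assms by (simp add: scalar_prod_def atLeast0LessThan)

text \<open>Both sides sum A(r,l) B(l,c) C(r,c), in different orders. With its right-hand analogue
  this adjointness replaces all entrywise computation with products in the norm estimates
  below.\<close>

lemma frob_inner_mult_left:
  assumes "A \<in> carrier_mat n m" "B \<in> carrier_mat m k" "C \<in> carrier_mat n k"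
  shows "frob_inner (A * B) C = frob_inner B (A\<^sup>T * C)"
proof -
  have AT: "A\<^sup>T \<in> carrier_mat m n" using assms by simp
  have "frob_inner (A * B) C = (\<Sum>r<n. \<Sum>c<k. \<Sum>l<m. A $$ (r, l) * B $$ (l, c) * C $$ (r, c))"
    using assms by (simp add: frob_inner_def mult_mat_index[OF assms(1,2)] sum_distrib_right
      del: index_mult_mat(1))
  also have "\<dots> = (\<Sum>r<n. \<Sum>l<m. \<Sum>c<k. A $$ (r, l) * B $$ (l, c) * C $$ (r, c))"
    by (rule sum.cong[OF refl], rule sum.swap)
  also have "\<dots> = (\<Sum>l<m. \<Sum>r<n. \<Sum>c<k. A $$ (r, l) * B $$ (l, c) * C $$ (r, c))"
    by (rule sum.swap)
  also have "\<dots> = (\<Sum>l<m. \<Sum>c<k. \<Sum>r<n. A $$ (r, l) * B $$ (l, c) * C $$ (r, c))"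
    by (rule sum.cong[OF refl], rule sum.swap)
  also have "\<dots> = frob_inner B (A\<^sup>T * C)"
    using assms by (simp add: frob_inner_def mult_mat_index[OF AT assms(3)] sum_distrib_left
      algebra_simps del: index_mult_mat(1))
  finally show ?thesis .
qed

lemma frob_inner_mult_right:
  assumes "A \<in> carrier_mat n m" "B \<in> carrier_mat m k" "C \<in> carrier_mat n k"
  shows "frob_inner (A * B) C = frob_inner A (C * B\<^sup>T)"
proof -
  have "frob_inner (A * B) C = frob_inner (B\<^sup>T * A\<^sup>T) C\<^sup>T"
    using assms frob_inner_transpose[of "A * B" n k C] by (simp add: transpose_mult)
  also have "\<dots> = frob_inner A\<^sup>T (B * C\<^sup>T)"
    using assms frob_inner_mult_left[of "B\<^sup>T" k m "A\<^sup>T" n "C\<^sup>T"] by simp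
  also have "B * C\<^sup>T = (C * B\<^sup>T)\<^sup>T"
    using assms transpose_mult[of C n k "B\<^sup>T" m] by simp
  also have "frob_inner A\<^sup>T (C * B\<^sup>T)\<^sup>T = frob_inner A (C * B\<^sup>T)"
    using assms frob_inner_transpose[of A n m "C * B\<^sup>T"] by simp
  finally show ?thesis .
qed

lemma frob_inner_le:
  assumes "M \<in> carrier_mat m k" "N \<in> carrier_mat m k"
  shows "\<bar>frob_inner M N\<bar> \<le> frob_norm M * frob_norm N"
proof -
  have "\<bar>frob_inner M N\<bar> \<le> (\<Sum>x\<in>{..<m} \<times> {..<k}. \<bar>M $$ x\<bar> * \<bar>N $$ x\<bar>)"
    using assms sum_abs[of "\<lambda>x. M $$ x * N $$ x" "{..<m} \<times> {..<k}"]
    by (simp add: frob_inner_def sum.cartesian_product abs_mult)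
  also have "\<dots> \<le> frob_norm M * frob_norm N"
    using L2_set_mult_ineq[of "($$) M" "($$) N" "{..<m} \<times> {..<k}"]
      assms by (simp add: frob_norm_eq_L2_set)
  finally show ?thesis .
qed

lemma frob_norm_triangle:
  assumes "M \<in> carrier_mat m k" "N \<in> carrier_mat m k"
  shows "frob_norm (M + N) \<le> frob_norm M + frob_norm N"
proof -
  have "frob_norm (M + N) = L2_set (\<lambda>x. M $$ x + N $$ x) ({..<m} \<times> {..<k})"
    using assms by (subst frob_norm_eq_L2_set[of _ m k]) (auto intro!: L2_set_cong)
  then show ?thesis
    using L2_set_triangle_ineq[of "($$) M" "($$) N" "{..<m} \<times> {..<k}"] assms
    by (simp add: frob_norm_eq_L2_set)
qed

lemma frob_norm_triangle_minus:
  assumes "M \<in> carrier_mat m k" "N \<in> carrier_mat m k"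
  shows "frob_norm (M - N) \<le> frob_norm M + frob_norm N"
proof -
  have "M - N = M + - N" using assms by (intro eq_matI) auto
  then show ?thesis
    using frob_norm_triangle[of M m k "- N"] frob_norm_uminus[OF assms(2)] assms by simp
qed

lemma frob_norm_mono:
  assumes "M \<in> carrier_mat m k" "N \<in> carrier_mat m k" "0 \<le> t"
    and "\<And>r c. r < m \<Longrightarrow> c < k \<Longrightarrow> \<bar>M $$ (r, c)\<bar> \<le> t * \<bar>N $$ (r, c)\<bar>"
  shows "frob_norm M \<le> t * frob_norm N"
proof -
  have "frob_norm M = L2_set (\<lambda>x. \<bar>M $$ x\<bar>) ({..<m} \<times> {..<k})"
    using assms by (simp add: frob_norm_eq_L2_set L2_set_def)
  also have "\<dots> \<le> L2_set (\<lambda>x. t * \<bar>N $$ x\<bar>) ({..<m} \<times> {..<k})"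
    using assms(4) by (intro L2_set_mono) auto
  also have "\<dots> = t * L2_set (\<lambda>x. \<bar>N $$ x\<bar>) ({..<m} \<times> {..<k})"
    using assms(3) by (simp add: L2_set_right_distrib)
  also have "L2_set (\<lambda>x. \<bar>N $$ x\<bar>) ({..<m} \<times> {..<k}) = frob_norm N"
    using assms by (simp add: frob_norm_eq_L2_set L2_set_def)
  finally show ?thesis .
qed

text \<open>Cauchy-Schwarz bounds each entry of the product by a row norm of \<open>A\<close> times
  a column norm of \<open>B\<close>, and the double sum of the squared bounds factors.\<close>

lemma frob_norm_mult_le:
  assumes "A \<in> carrier_mat n m" "B \<in> carrier_mat m k"
  shows "frob_norm (A * B) \<le> frob_norm A * frob_norm B"
proof -
  have "(frob_norm (A * B))\<^sup>2 = (\<Sum>r<n. \<Sum>c<k. (\<Sum>l<m. A $$ (r, l) * B $$ (l, c))\<^sup>2)"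
    using assms by (simp add: frob_norm_def sum_nonneg mult_mat_index[OF assms]
      del: index_mult_mat(1))
  also have "\<dots> \<le> (\<Sum>r<n. \<Sum>c<k. (\<Sum>l<m. (A $$ (r, l))\<^sup>2) * (\<Sum>l<m. (B $$ (l, c))\<^sup>2))"
  proof (intro sum_mono)
    fix r c
    let ?a = "\<lambda>l. A $$ (r, l)" and ?b = "\<lambda>l. B $$ (l, c)"
    have "\<bar>\<Sum>l<m. ?a l * ?b l\<bar> \<le> L2_set ?a {..<m} * L2_set ?b {..<m}"
      using sum_abs[of "\<lambda>l. ?a l * ?b l" "{..<m}"] L2_set_mult_ineq[of ?a ?b "{..<m}"]
      by (simp add: abs_mult)
    then have "(\<Sum>l<m. ?a l * ?b l)\<^sup>2 \<le> (L2_set ?a {..<m} * L2_set ?b {..<m})\<^sup>2"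
      by (meson abs_le_square_iff abs_ge_self order_trans)
    then show "(\<Sum>l<m. ?a l * ?b l)\<^sup>2 \<le> (\<Sum>l<m. (?a l)\<^sup>2) * (\<Sum>l<m. (?b l)\<^sup>2)"
      by (simp add: L2_set_def power_mult_distrib sum_nonneg)
  qed
  also have "\<dots> = (\<Sum>r<n. \<Sum>l<m. (A $$ (r, l))\<^sup>2) * (\<Sum>c<k. \<Sum>l<m. (B $$ (l, c))\<^sup>2)"
    by (simp add: sum_product)
  also have "(\<Sum>c<k. \<Sum>l<m. (B $$ (l, c))\<^sup>2) = (\<Sum>l<m. \<Sum>c<k. (B $$ (l, c))\<^sup>2)"
    by (rule sum.swap)
  also have "(\<Sum>r<n. \<Sum>l<m. (A $$ (r, l))\<^sup>2) * \<dots> = (frob_norm A * frob_norm B)\<^sup>2"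
    using assms by (simp add: frob_norm_def sum_nonneg power_mult_distrib)
  finally show ?thesis
    by (rule power2_le_imp_le) simp
qed

lemma frob_norm_isometry:
  assumes Q: "Q \<in> carrier_mat n m" "Q\<^sup>T * Q = 1\<^sub>m m" and X: "X \<in> carrier_mat m k"
  shows "frob_norm (Q * X) = frob_norm X"
proof -
  have "Q\<^sup>T * (Q * X) = X"
    using Q X assoc_mult_mat[of "Q\<^sup>T" m n Q m X k] by simp
  then have "(frob_norm (Q * X))\<^sup>2 = (frob_norm X)\<^sup>2"
    using frob_inner_mult_left[OF Q(1) X, of "Q * X"] Q(1) X by (simp add: frob_inner_self)
  then show ?thesis by simp
qed

text \<open>With g = Q^T E, adjointness gives |g|^2 = <Q g, E>, and |Q g| = |g| because
  \<open>Q\<close> is an isometry.\<close>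

lemma frob_norm_transpose_isometry_le:
  assumes Q: "Q \<in> carrier_mat n m" "Q\<^sup>T * Q = 1\<^sub>m m" and E: "E \<in> carrier_mat n k"
  shows "frob_norm (Q\<^sup>T * E) \<le> frob_norm E"
proof -
  define g where "g = Q\<^sup>T * E"
  have g: "g \<in> carrier_mat m k" using Q E by (simp add: g_def)
  have "(frob_norm g)\<^sup>2 = frob_inner (Q * g) E"
    using frob_inner_mult_left[OF Q(1) g E] by (simp add: frob_inner_self flip: g_def)
  also have "\<dots> \<le> frob_norm E * frob_norm g"
    using frob_inner_le[of "Q * g" n k E] frob_norm_isometry[OF Q g] Q g E by (simp add: mult.commute)
  finally show ?thesis
    using mult_le_if_mult_power2_le[of 1 "frob_norm g" "frob_norm E"] by (simp add: g_def)
qed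

section \<open>Positive semidefinite matrices and the Frobenius inner product\<close>

lemma frob_inner_psd_nonneg:
  assumes "psd_mat P" "P \<in> carrier_mat m m" "X \<in> carrier_mat m k"
  shows "0 \<le> frob_inner X (P * X)"
proof -
  have "frob_inner X (P * X) = (\<Sum>c<k. \<Sum>r<m. X $$ (r, c) * (P * X) $$ (r, c))"
    using assms by (simp add: frob_inner_def del: index_mult_mat(1)) (rule sum.swap)
  also have "\<dots> = (\<Sum>c<k. col X c \<bullet> (P *\<^sub>v col X c))"
    using assms by (intro sum.cong refl) (simp add: scalar_prod_def atLeast0LessThan)
  also have "\<dots> \<ge> 0"
    using assms by (intro sum_nonneg) (auto simp: psd_mat_def)
  finally show ?thesis .
qed

text \<open>A smallest-eigenvalue bound obtained without diagonalizing \<open>P\<close>. The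
  hypothesis \<open>low\<close> makes \<open>P\<close> invertible; with Y = P^(-1) X, nonnegativity
  of the form of \<open>P\<close> at X - \<mu> Y reads 2 \<mu> |X|^2 \<le> <X, P X> + \<mu>^2 <Y,
  X>, and \<open>low\<close> at \<open>Y\<close> bounds the last term by \<mu> |X|^2.\<close>

lemma psd_lower_bound:
  assumes psd: "psd_mat P" and P: "P \<in> carrier_mat m m" and X: "X \<in> carrier_mat m k"
    and \<mu>: "0 < \<mu>"
    and low: "\<And>k Y. Y \<in> carrier_mat m k \<Longrightarrow> \<mu> * frob_norm Y \<le> frob_norm (P * Y)"
  shows "\<mu> * (frob_norm X)\<^sup>2 \<le> frob_inner X (P * X)"
proof -
  have "det P \<noteq> 0"
  proof
    assume "det P = 0"
    then obtain x where x: "x \<in> carrier_vec m" "x \<noteq> 0\<^sub>v m" "P *\<^sub>v x = 0\<^sub>v m"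
      using det_0_iff_vec_prod_zero[OF P] by auto
    \<comment> \<open>The kernel vector as a one-column matrix, so that \<open>low\<close> applies
      with \<open>k = 1\<close> and forces it to vanish.\<close>
    define Y where "Y = mat m 1 (\<lambda>(r, c). x $ r)"
    have Y: "Y \<in> carrier_mat m 1" by (simp add: Y_def)
    have "col Y 0 = x" using x by (intro eq_vecI) (auto simp: Y_def)
    then have "P * Y = 0\<^sub>m m 1"
      using P Y col_mult2[OF P Y, of 0] x(3) by (intro mat_col_eqI) auto
    then have "frob_norm (P * Y) = 0" by (simp add: frob_norm_def)
    with low[OF Y] \<mu> have "frob_norm Y \<le> 0" by (simp add: mult_le_0_iff)
    then have "(\<Sum>r<m. (x $ r)\<^sup>2) \<le> 0"
      by (simp add: frob_norm_def Y_def)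
    then have "\<forall>r<m. x $ r = 0"
      using sum_nonneg_eq_0_iff[of "{..<m}" "\<lambda>r. (x $ r)\<^sup>2"]
      by (simp add: sum_nonneg order_antisym)
    then have "x = 0\<^sub>v m" using x(1) by (intro eq_vecI) auto
    with x(2) show False ..
  qed
  \<comment> \<open>This is P^(-1) X, the inverse being written through the adjugate.\<close>
  define Y where "Y = (1 / det P) \<cdot>\<^sub>m adj_mat P * X"
  have Y: "Y \<in> carrier_mat m k"
    unfolding Y_def using adj_mat(1)[OF P] X by (intro mult_carrier_mat[of _ m m]) auto
  have "P * Y = P * ((1 / det P) \<cdot>\<^sub>m adj_mat P) * X"
    unfolding Y_def using adj_mat(1)[OF P] X P by (subst assoc_mult_mat[of _ m m _ m _ k]) auto
  also have "P * ((1 / det P) \<cdot>\<^sub>m adj_mat P) = 1\<^sub>m m"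
    using adj_mat(1,2)[OF P] P \<open>det P \<noteq> 0\<close>
    by (subst mult_smult_distrib[of _ m m _ m]) auto
  finally have PY: "P * Y = X" using X by simp
  have PT: "P\<^sup>T = P" using psd by (simp add: psd_mat_def symmetric_mat_def)
  have YPX: "frob_inner Y (P * X) = (frob_norm X)\<^sup>2"
    using frob_inner_mult_left[OF P Y X] PY PT by (simp add: frob_inner_self)
  have YX: "\<mu> * frob_inner Y X \<le> (frob_norm X)\<^sup>2"
  proof -
    have "\<mu> * frob_inner Y X \<le> \<mu> * (frob_norm Y * frob_norm X)"
      using frob_inner_le[OF Y X] \<mu> by (intro mult_left_mono) auto
    also have "\<dots> \<le> frob_norm X * frob_norm X"
      using mult_right_mono[OF low[OF Y], of "frob_norm X"] PY by (simp add: mult.assoc)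
    finally show ?thesis by (simp add: power2_eq_square)
  qed
  have tY: "\<mu> \<cdot>\<^sub>m Y \<in> carrier_mat m k" using Y by simp
  have PX: "P * X \<in> carrier_mat m k" using P X by simp
  let ?T = "X - \<mu> \<cdot>\<^sub>m Y"
  have T: "?T \<in> carrier_mat m k" using X Y by (intro minus_carrier_mat) simp
  have \<mu>X: "\<mu> \<cdot>\<^sub>m X \<in> carrier_mat m k" using X by simp
  then have T': "P * X - \<mu> \<cdot>\<^sub>m X \<in> carrier_mat m k" by (rule minus_carrier_mat)
  have "P * ?T = P * X - \<mu> \<cdot>\<^sub>m X"
    using mult_minus_distrib_mat[OF P X tY] mult_smult_distrib[OF P Y, of \<mu>] PY by simp
  then have "0 \<le> frob_inner ?T (P * X - \<mu> \<cdot>\<^sub>m X)"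
    using frob_inner_psd_nonneg[OF psd P T] by simp
  also have "\<dots> = frob_inner (P * X - \<mu> \<cdot>\<^sub>m X) ?T"
    by (rule frob_inner_commute[OF T T'])
  also have "\<dots> = frob_inner (P * X) ?T - frob_inner (\<mu> \<cdot>\<^sub>m X) ?T"
    by (rule frob_inner_minus_left[OF PX \<mu>X T])
  also have "frob_inner (P * X) ?T = frob_inner (P * X) X - \<mu> * frob_inner (P * X) Y"
    using PX X Y by (simp add: frob_inner_minus_right[of _ m k] frob_inner_smult_right[of _ m k])
  also have "frob_inner (P * X) X = frob_inner X (P * X)"
    using PX X by (rule frob_inner_commute)
  also have "frob_inner (P * X) Y = (frob_norm X)\<^sup>2"
    using frob_inner_commute[OF PX Y] YPX by simp
  also have "frob_inner (\<mu> \<cdot>\<^sub>m X) ?T = \<mu> * frob_inner ?T X"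
    using frob_inner_commute[OF _ T, of "\<mu> \<cdot>\<^sub>m X"] frob_inner_smult_right[OF T X] X by simp
  also have "frob_inner ?T X = (frob_norm X)\<^sup>2 - \<mu> * frob_inner Y X"
    using frob_inner_minus_left[OF X tY X] frob_inner_commute[OF tY X]
      frob_inner_smult_right[OF X Y] frob_inner_commute[OF X Y] by (simp add: frob_inner_self)
  finally have "2 * (\<mu> * (frob_norm X)\<^sup>2) \<le> frob_inner X (P * X) + \<mu> * (\<mu> * frob_inner Y X)"
    by (simp add: algebra_simps)
  also have "\<mu> * (\<mu> * frob_inner Y X) \<le> \<mu> * (frob_norm X)\<^sup>2"
    using YX \<mu> by (intro mult_left_mono) auto
  finally show ?thesis by simp
qed

section \<open>The minimal symmetric perturbation\<close>

text \<open>Symmetry of \<open>N\<close> makes the two mixed terms equal, and adjointness moves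
  \<open>Q\<close> onto \<open>N\<close>. The right side sees \<open>N\<close> only through
  \<open>N * Q\<close>, which the backward error constraint prescribes; hence the inner product is
  the same for all admissible \<open>N\<close>.\<close>

lemma symmetric_perturbation_inner:
  assumes Q: "Q \<in> carrier_mat n m" and Z: "Z \<in> carrier_mat n m" and X: "X \<in> carrier_mat m m"
    and N: "N \<in> carrier_mat n n" "symmetric_mat N"
  shows "frob_inner N (Z * Q\<^sup>T + Q * Z\<^sup>T + Q * X * Q\<^sup>T) =
    2 * frob_inner (N * Q) Z + frob_inner (N * Q) (Q * X)"
proof -
  have NT: "N\<^sup>T = N" using N by (simp add: symmetric_mat_def)
  have 1: "frob_inner N (Z * Q\<^sup>T) = frob_inner (N * Q) Z"
    using frob_inner_mult_right[OF N(1) Q Z] by simp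
  have "frob_inner N (Q * Z\<^sup>T) = frob_inner N\<^sup>T (Q * Z\<^sup>T)\<^sup>T"
    using Q Z N NT by (subst NT[symmetric], subst frob_inner_transpose[of _ n n]) auto
  also have "(Q * Z\<^sup>T)\<^sup>T = Z * Q\<^sup>T"
    using Q Z transpose_mult[of Q n m "Z\<^sup>T" n] by simp
  finally have 2: "frob_inner N (Q * Z\<^sup>T) = frob_inner (N * Q) Z"
    using 1 NT by simp
  have 3: "frob_inner N (Q * X * Q\<^sup>T) = frob_inner (N * Q) (Q * X)"
    using frob_inner_mult_right[OF N(1) Q, of "Q * X"] Q X by simp
  have c: "Z * Q\<^sup>T \<in> carrier_mat n n" "Q * Z\<^sup>T \<in> carrier_mat n n" "Q * X * Q\<^sup>T \<in> carrier_mat n n"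
    using Q X Z by auto
  show ?thesis
    using N(1) c by (simp add: frob_inner_add_right[of _ n n] 1 2 3)
qed

text \<open>The minimizer is orthogonal to all differences of admissible perturbations, so
  Cauchy-Schwarz shows its minimality. Its norm splits because the columns of \<open>Z\<close> are
  orthogonal to the range of \<open>Q\<close>.\<close>

lemma sym_backward_error_eq:
  assumes A: "A \<in> carrier_mat n n" and L: "L \<in> carrier_mat m m"
    and Q: "Q \<in> carrier_mat n m" and QQ: "Q\<^sup>T * Q = 1\<^sub>m m"
    and Z: "Z \<in> carrier_mat n m" and QZ: "Q\<^sup>T * Z = 0\<^sub>m m m"
    and X: "X \<in> carrier_mat m m" "symmetric_mat X"
    and res: "A * Q = Q * L + (Z + Q * X)"
  shows "(sym_backward_error A Q L)\<^sup>2 = 2 * (frob_norm Z)\<^sup>2 + (frob_norm X)\<^sup>2"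
    and "0 \<le> sym_backward_error A Q L"
proof -
  \<comment> \<open>The residual \<open>Z + Q * X\<close> is A Q - Q L, so the optimal perturbation
    is \<open>- D\<close>.\<close>
  define D where "D = Z * Q\<^sup>T + Q * Z\<^sup>T + Q * X * Q\<^sup>T"
  have c: "Z * Q\<^sup>T \<in> carrier_mat n n" "Q * Z\<^sup>T \<in> carrier_mat n n" "Q * X * Q\<^sup>T \<in> carrier_mat n n"
    "Q * X \<in> carrier_mat n m" "Q * L \<in> carrier_mat n m" "A * Q \<in> carrier_mat n m"
    using Q X Z L A by auto
  have D: "D \<in> carrier_mat n n" using c by (simp add: D_def)
  have XT: "X\<^sup>T = X" using X by (simp add: symmetric_mat_def)
  have ZQ: "Z\<^sup>T * Q = 0\<^sub>m m m"
    using QZ transpose_mult[of "Q\<^sup>T" m n Z m] Q Z by simp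
  have "(Q * X * Q\<^sup>T)\<^sup>T = Q * X * Q\<^sup>T"
    using Q X XT transpose_mult[OF c(4), of "Q\<^sup>T" n]
    by (simp add: transpose_mult[of Q n m X m] assoc_mult_mat[of Q n m X m "Q\<^sup>T" n])
  moreover have "(Z * Q\<^sup>T)\<^sup>T = Q * Z\<^sup>T" "(Q * Z\<^sup>T)\<^sup>T = Z * Q\<^sup>T"
    using Q Z by (simp_all add: transpose_mult[of _ n m _ n])
  ultimately have symD: "symmetric_mat D"
    unfolding symmetric_mat_def D_def using c comm_add_mat[OF c(1,2)]
    by (simp add: transpose_add[of _ n n] del: assoc_add_mat)
  have "D * Q = Z * Q\<^sup>T * Q + Q * Z\<^sup>T * Q + Q * X * Q\<^sup>T * Q"
    unfolding D_def add_mult_distrib_mat[OF add_carrier_mat[OF c(2)] c(3) Q]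
      add_mult_distrib_mat[OF c(1,2) Q] ..
  also have "Z * Q\<^sup>T * Q = Z"
    using Q Z QQ by (simp add: assoc_mult_mat[of _ n m _ n _ m])
  also have "Q * Z\<^sup>T * Q = 0\<^sub>m n m"
    using Q Z ZQ by (simp add: assoc_mult_mat[of _ n m _ n _ m])
  also have "Q * X * Q\<^sup>T * Q = Q * X"
    using Q QQ by (simp add: assoc_mult_mat[OF c(4) _ Q] right_mult_one_mat[OF c(4)])
  finally have DQ: "D * Q = Z + Q * X" using Z by simp
  have ZQX: "frob_inner Z (Q * X) = 0"
  proof -
    have "frob_inner Z (Q * X) = frob_inner X (Q\<^sup>T * Z)"
      using frob_inner_mult_left[OF Q X(1) Z] frob_inner_commute[OF Z c(4)] by simp
    then show ?thesis by (simp add: QZ frob_inner_zero_right[OF X(1)])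
  qed
  have QXQX: "frob_inner (Q * X) (Q * X) = (frob_norm X)\<^sup>2"
    by (simp add: frob_inner_self frob_norm_isometry[OF Q QQ X(1)])
  have val: "2 * frob_inner (Z + Q * X) Z + frob_inner (Z + Q * X) (Q * X)
      = 2 * (frob_norm Z)\<^sup>2 + (frob_norm X)\<^sup>2" (is "_ = ?d")
    using Z c ZQX frob_inner_commute[OF Z c(4)]
    by (simp add: frob_inner_add_left[of _ n m] QXQX frob_inner_self[of Z])
  have normD: "(frob_norm D)\<^sup>2 = ?d"
    using symmetric_perturbation_inner[OF Q Z X(1) D symD] val
    by (simp add: DQ frob_inner_self[symmetric] flip: D_def)
  have ZX: "Z + Q * X \<in> carrier_mat n m" using c Z by simp
  have min: "frob_norm D \<le> frob_norm N"
    if N: "N \<in> carrier_mat n n" "symmetric_mat N" "(A + N) * Q = Q * L" for N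
  proof -
    have NQ: "N * Q = - (Z + Q * X)"
    proof (rule eq_matI)
      fix r k assume rk: "r < dim_row (- (Z + Q * X))" "k < dim_col (- (Z + Q * X))"
      have "(A * Q + N * Q) $$ (r, k) = (Q * L) $$ (r, k)"
        using N A Q by (simp add: add_mult_distrib_mat[of _ n n])
      with rk res show "(N * Q) $$ (r, k) = (- (Z + Q * X)) $$ (r, k)"
        using N(1) A Q Z X L c by (simp del: index_mult_mat(1))
    qed (use N Q Z X in auto)
    \<comment> \<open>\<open>N\<close> and \<open>- D\<close> agree after multiplication by
      \<open>Q\<close>, so this is the value - |D|^2 taken at \<open>N = - D\<close>.\<close>
    have "frob_inner N D = - ?d"
      using symmetric_perturbation_inner[OF Q Z X(1) N(1,2)] val ZX Z c(4)
      by (simp add: NQ frob_inner_uminus_left[of _ n m] flip: D_def)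
    then have "(frob_norm D)\<^sup>2 \<le> frob_norm N * frob_norm D"
      using frob_inner_le[OF N(1) D] normD by simp
    then show ?thesis
      using mult_le_if_mult_power2_le[of 1 "frob_norm D" "frob_norm N"] by simp
  qed
  have "(A + - D) * Q = A * Q + - (D * Q)"
    using A D Q by (simp add: add_mult_distrib_mat[of _ n n] uminus_mult_left_mat)
  also have "\<dots> = Q * L + ((Z + Q * X) + - (Z + Q * X))"
    unfolding res DQ using c(5) ZX by (intro assoc_add_mat) auto
  also have "\<dots> = Q * L"
    unfolding add_uminus_minus_mat[OF ZX ZX] minus_r_inv_mat[OF ZX]
    using c(5) by (rule right_add_zero_mat)
  finally have adm: "(A + - D) * Q = Q * L" .
  have sbe: "sym_backward_error A Q L = frob_norm D"
    unfolding sym_backward_error_def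
  proof (rule Least_equality)
    have "symmetric_mat (- D)"
      using symD D unfolding symmetric_mat_def by (metis transpose_uminus)
    then show "\<exists>N\<in>carrier_mat (dim_row A) (dim_row A).
        symmetric_mat N \<and> (A + N) * Q = Q * L \<and> frob_norm D = frob_norm N"
      using A D adm frob_norm_uminus[OF D] by (intro bexI[of _ "- D"]) auto
  qed (use A min in auto)
  then show "(sym_backward_error A Q L)\<^sup>2 = ?d" "0 \<le> sym_backward_error A Q L"
    using normD by auto
qed

section \<open>Polar factors and the backward error\<close>

lemma polar_gram:
  assumes "polar_decomposition V Q P" "V \<in> carrier_mat n m"
  shows "V\<^sup>T * V = P * P" "V\<^sup>T = P * Q\<^sup>T"
proof -
  have Q: "Q \<in> carrier_mat n m" and P: "P \<in> carrier_mat m m" and V: "V = Q * P"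
    and QQ: "Q\<^sup>T * Q = 1\<^sub>m m" and PT: "P\<^sup>T = P"
    using assms by (auto simp: polar_decomposition_def psd_mat_def symmetric_mat_def)
  show VT: "V\<^sup>T = P * Q\<^sup>T" using transpose_mult[OF Q P] V PT by simp
  have "V\<^sup>T * V = P * (Q\<^sup>T * (Q * P))"
    using VT V P Q by (simp add: assoc_mult_mat[of P m m _ n _ m])
  also have "Q\<^sup>T * (Q * P) = P"
    using Q P QQ assoc_mult_mat[of "Q\<^sup>T" m n Q m P m] by simp
  finally show "V\<^sup>T * V = P * P" .
qed

text \<open>Write P^2 = I + H with |H| = \<omega>. Then |P X|^2 = <X, P^2 X> = |X|^2 + <X, H X>, and
  the last term is at most \<omega> |X|^2 in absolute value.\<close>

lemma frob_norm_sqrt_mult_bounds: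
  assumes P: "P \<in> carrier_mat m m" "symmetric_mat P" and X: "X \<in> carrier_mat m k"
  defines "\<omega> \<equiv> frob_norm (P * P - 1\<^sub>m m)"
  shows "(1 - \<omega>) * (frob_norm X)\<^sup>2 \<le> (frob_norm (P * X))\<^sup>2"
    and "(frob_norm (P * X))\<^sup>2 \<le> (1 + \<omega>) * (frob_norm X)\<^sup>2"
proof -
  define H where "H = P * P - 1\<^sub>m m"
  have c: "P * X \<in> carrier_mat m k" "H \<in> carrier_mat m m" "H * X \<in> carrier_mat m k"
    using P X by (auto simp: H_def intro: minus_carrier_mat)
  have PT: "P\<^sup>T = P" using P by (simp add: symmetric_mat_def)
  have "H * X = P * (P * X) - X"
    unfolding H_def using P X by (simp add: minus_mult_distrib_mat[of _ m m] assoc_mult_mat[of _ m m _ m _ k])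
  then have "frob_inner X (H * X) = frob_inner X (P * (P * X)) - frob_inner X X"
    using P X c by (simp add: frob_inner_minus_right[of _ m k])
  moreover have "frob_inner X (P * (P * X)) = (frob_norm (P * X))\<^sup>2"
    using frob_inner_mult_left[OF P(1) X c(1)] PT by (simp add: frob_inner_self)
  moreover have "\<bar>frob_inner X (H * X)\<bar> \<le> \<omega> * (frob_norm X)\<^sup>2"
  proof -
    have "\<bar>frob_inner X (H * X)\<bar> \<le> frob_norm X * frob_norm (H * X)"
      using X c by (intro frob_inner_le)
    also have "\<dots> \<le> frob_norm X * (\<omega> * frob_norm X)"
      using frob_norm_mult_le[OF c(2) X] by (intro mult_left_mono) (simp_all add: \<omega>_def H_def)
    finally show ?thesis by (simp add: power2_eq_square mult_ac)
  qed
  ultimately show "(1 - \<omega>) * (frob_norm X)\<^sup>2 \<le> (frob_norm (P * X))\<^sup>2"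
    and "(frob_norm (P * X))\<^sup>2 \<le> (1 + \<omega>) * (frob_norm X)\<^sup>2"
    by (simp_all add: frob_inner_self algebra_simps abs_le_iff)
qed

text \<open>The residual equation is split into its part in the range of \<open>Q\<close>, which
  controls \<open>X\<close>, and the orthogonal part, which controls \<open>Z\<close> and is free of
  \<open>\<Phi>\<close>. Pythagoras for the two parts of \<open>E\<close> recombines the
  estimates.\<close>

lemma sym_backward_error_polar_le:
  assumes A: "A \<in> carrier_mat n n" "symmetric_mat A"
    and V: "V \<in> carrier_mat n m" and polar: "polar_decomposition V Q P"
    and L: "L \<in> carrier_mat m m" "symmetric_mat L"
    and E: "E \<in> carrier_mat n m" and \<Phi>: "\<Phi> \<in> carrier_mat m m"
    and res: "A * V + V * \<Phi> = V * L + E"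
    and loss: "frob_norm (V\<^sup>T * V - 1\<^sub>m m) < 1"
  shows "sqrt (1 - frob_norm (V\<^sup>T * V - 1\<^sub>m m)) * sym_backward_error A Q L
    \<le> sqrt 2 * frob_norm E + frob_norm (P * \<Phi>)"
proof -
  have Q: "Q \<in> carrier_mat n m" and P: "P \<in> carrier_mat m m" and VQP: "V = Q * P"
    and QQ: "Q\<^sup>T * Q = 1\<^sub>m m" and psd: "psd_mat P" and symP: "symmetric_mat P"
    using polar V by (auto simp: polar_decomposition_def psd_mat_def)
  have PT: "P\<^sup>T = P" and LT: "L\<^sup>T = L" and AT: "A\<^sup>T = A"
    using symP L A by (simp_all add: symmetric_mat_def)
  have QT: "Q\<^sup>T \<in> carrier_mat m n" using Q by simp
  define \<mu> where "\<mu> = sqrt (1 - frob_norm (V\<^sup>T * V - 1\<^sub>m m))"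
  have \<mu>: "0 < \<mu>" using loss by (simp add: \<mu>_def)
  have low: "\<mu> * frob_norm Y \<le> frob_norm (P * Y)" if "Y \<in> carrier_mat m k" for k Y
  proof (rule power2_le_imp_le)
    show "(\<mu> * frob_norm Y)\<^sup>2 \<le> (frob_norm (P * Y))\<^sup>2"
      using frob_norm_sqrt_mult_bounds(1)[OF P symP that] loss
      by (simp add: power_mult_distrib \<mu>_def polar_gram(1)[OF polar V])
  qed simp
  \<comment> \<open>The compression of \<open>A\<close> to the range of \<open>Q\<close>;
    \<open>X\<close> measures its distance from \<open>L\<close>, and \<open>Z\<close> is the part
    of \<open>A * Q\<close> outside that range.\<close>
  define M where "M = Q\<^sup>T * (A * Q)"
  define X where "X = M - L"
  define Z where "Z = A * Q - Q * M"
  have AQ: "A * Q \<in> carrier_mat n m" using A Q by simp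
  have M: "M \<in> carrier_mat m m" using AQ Q by (simp add: M_def)
  have MT: "M\<^sup>T = M"
    unfolding M_def using A Q AQ AT transpose_mult[OF QT AQ] transpose_mult[OF A(1) Q]
    by (simp add: assoc_mult_mat[of _ m n _ n _ m])
  have X: "X \<in> carrier_mat m m" using M L by (simp add: X_def minus_carrier_mat)
  have XT: "X\<^sup>T = X" using M L MT LT by (simp add: X_def transpose_minus)
  have QM: "Q * M \<in> carrier_mat n m" and QL: "Q * L \<in> carrier_mat n m" using Q M L by auto
  have Z: "Z \<in> carrier_mat n m" using QM by (simp add: Z_def minus_carrier_mat)
  have QZ: "Q\<^sup>T * Z = 0\<^sub>m m m"
  proof -
    have "Q\<^sup>T * (Q * M) = M"
      using Q M QQ assoc_mult_mat[OF QT Q M] by simp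
    then show ?thesis
      using M mult_minus_distrib_mat[OF QT AQ QM] by (simp add: Z_def flip: M_def)
  qed
  have "Q * X = Q * M - Q * L"
    unfolding X_def using Q M L(1) by (rule mult_minus_distrib_mat)
  then have resQ: "A * Q = Q * L + (Z + Q * X)"
    using A Q M L by (intro eq_matI) (auto simp: Z_def simp del: index_mult_mat(1))
  have symX: "symmetric_mat X" using XT by (simp add: symmetric_mat_def)
  note sbe = sym_backward_error_eq[OF A(1) L(1) Q QQ Z QZ X symX resQ]

  define g where "g = Q\<^sup>T * E"
  have g: "g \<in> carrier_mat m m" using Q E by (simp add: g_def)
  have VL: "V * L \<in> carrier_mat n m" and V\<Phi>: "V * \<Phi> \<in> carrier_mat n m"
    and AV: "A * V \<in> carrier_mat n m" and P\<Phi>: "P * \<Phi> \<in> carrier_mat m m"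
    and PL: "P * L \<in> carrier_mat m m" and MP: "M * P \<in> carrier_mat m m"
    using V L \<Phi> A P M by auto
  have QTV: "Q\<^sup>T * (V * Y) = P * Y" if Y: "Y \<in> carrier_mat m m" for Y
  proof -
    have "V * Y = Q * (P * Y)" using VQP Q P Y by simp
    then show ?thesis using assoc_mult_mat[OF QT Q, of "P * Y" m] QQ P Y by simp
  qed
  have QTAV: "Q\<^sup>T * (A * V) = M * P"
    unfolding VQP M_def assoc_mult_mat[OF A(1) Q P, symmetric] assoc_mult_mat[OF QT AQ P] ..
  have proj: "M * P + P * \<Phi> = P * L + g"
    using arg_cong[OF res, of "\<lambda>Y. Q\<^sup>T * Y"] QTAV QTV[OF \<Phi>] QTV[OF L(1)]
    by (simp add: mult_add_distrib_mat[OF QT AV V\<Phi>] mult_add_distrib_mat[OF QT VL E] flip: g_def)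
  define S where "S = M * P - P * L"
  have S: "S \<in> carrier_mat m m" using PL by (simp add: S_def minus_carrier_mat)
  have S_eq: "S = g - P * \<Phi>"
  proof (rule eq_matI)
    fix r c assume "r < dim_row (g - P * \<Phi>)" "c < dim_col (g - P * \<Phi>)"
    then show "S $$ (r, c) = (g - P * \<Phi>) $$ (r, c)"
      using arg_cong[OF proj, of "\<lambda>Y. Y $$ (r, c)"] P \<Phi> L(1) M g
      by (simp add: S_def del: index_mult_mat(1))
  qed (use S P\<Phi> in auto)
  txt \<open>The matrix \<open>M P - P L\<close> differs from \<open>P X\<close> by the commutator of \<open>M\<close> and \<open>P\<close>, which is
    skew-symmetric and hence orthogonal to \<open>X\<close>.\<close>
  have "frob_inner S X = frob_inner (M * P) X - frob_inner (P * L) X"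
    unfolding S_def using MP PL X by (rule frob_inner_minus_left)
  also have "frob_inner (M * P) X = frob_inner (P * M) X"
    using frob_inner_transpose[OF MP X] transpose_mult[OF M P] MT PT XT by simp
  also have "frob_inner (P * M) X - frob_inner (P * L) X = frob_inner (P * X) X"
    using mult_minus_distrib_mat[OF P M L(1)] frob_inner_minus_left[of "P * M" m m "P * L" X] M P PL X
    by (simp add: X_def)
  also have "\<dots> = frob_inner X (P * X)"
    using P X by (intro frob_inner_commute[of _ m m]) auto
  finally have SX: "frob_inner S X = frob_inner X (P * X)" .
  have "\<mu> * (frob_norm X)\<^sup>2 \<le> frob_inner S X"
    unfolding SX by (rule psd_lower_bound[OF psd P X \<mu> low])
  also have "\<dots> \<le> frob_norm S * frob_norm X"
    using frob_inner_le[OF S X] by simp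
  finally have X_le: "\<mu> * frob_norm X \<le> frob_norm S"
    by (rule mult_le_if_mult_power2_le) simp_all
  have S_le: "frob_norm S \<le> frob_norm g + frob_norm (P * \<Phi>)"
    unfolding S_eq using g P\<Phi> by (rule frob_norm_triangle_minus)

  define F where "F = Z * P"
  have F: "F \<in> carrier_mat n m" using Z P by (simp add: F_def)
  have Qg: "Q * g \<in> carrier_mat n m" using Q g by simp
  \<comment> \<open>Both \<open>V * \<Phi>\<close> and \<open>V * L\<close> lie in the range of
    \<open>Q\<close>, so the component of \<open>E\<close> orthogonal to it is that of
    \<open>A * V\<close>, namely \<open>Z * P\<close>.\<close>
  have E_eq: "E = F + Q * g"
  proof -
    have "Z * P = A * V - Q * (M * P)"
      unfolding Z_def VQP using A Q P M
      by (simp add: minus_mult_distrib_mat[OF AQ QM P] assoc_mult_mat[OF A(1) Q P])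
    moreover have "Q * (M * P + P * \<Phi>) = Q * (P * L + g)" using proj by simp
    then have "Q * (M * P) + V * \<Phi> = V * L + Q * g"
      using Q P \<Phi> L by (simp add: mult_add_distrib_mat[OF Q MP P\<Phi>] mult_add_distrib_mat[OF Q PL g] VQP
        assoc_mult_mat[OF Q P])
    ultimately show ?thesis
    proof -
      assume 1: "Z * P = A * V - Q * (M * P)" and 2: "Q * (M * P) + V * \<Phi> = V * L + Q * g"
      show ?thesis
      proof (rule eq_matI)
        fix r c assume "r < dim_row (F + Q * g)" "c < dim_col (F + Q * g)"
        then show "E $$ (r, c) = (F + Q * g) $$ (r, c)"
          using arg_cong[OF 2, of "\<lambda>Y. Y $$ (r, c)"] arg_cong[OF res, of "\<lambda>Y. Y $$ (r, c)"]
            Q M P A V \<Phi> L(1) g E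
          unfolding F_def 1 by (simp del: index_mult_mat(1))
      qed (use E F Qg in auto)
    qed
  qed
  have "Q\<^sup>T * F = 0\<^sub>m m m"
    unfolding F_def using assoc_mult_mat[OF QT Z P] QZ P by simp
  then have FQg: "frob_inner F (Q * g) = 0"
    using frob_inner_mult_left[OF Q g F] frob_inner_commute[OF F Qg]
    by (simp add: frob_inner_zero_right[OF g])
  have "frob_inner (Q * g) (Q * g) = frob_inner g g"
    by (simp add: frob_inner_self frob_norm_isometry[OF Q QQ g])
  then have pyth: "(frob_norm E)\<^sup>2 = (frob_norm F)\<^sup>2 + (frob_norm g)\<^sup>2"
    using F Qg FQg frob_inner_commute[OF F Qg] unfolding E_eq frob_inner_self[symmetric]
    by (simp add: frob_inner_add_left[of _ n m] frob_inner_add_right[of _ n m])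
  \<comment> \<open>\<open>low\<close> concerns multiplication by \<open>P\<close> from the left,
    hence the passage to the transpose of \<open>Z\<close>.\<close>
  have Z_le: "\<mu> * frob_norm Z \<le> frob_norm F"
    using low[of "Z\<^sup>T" n] Z transpose_mult[OF Z P] PT
    by (simp add: F_def frob_norm_transpose flip: frob_norm_transpose[of "Z * P"])

  have "(\<mu> * sym_backward_error A Q L)\<^sup>2 = 2 * (\<mu> * frob_norm Z)\<^sup>2 + (\<mu> * frob_norm X)\<^sup>2"
    using sbe(1) by (simp add: power_mult_distrib algebra_simps)
  also have "\<dots> \<le> 2 * (frob_norm F)\<^sup>2 + (frob_norm g + frob_norm (P * \<Phi>))\<^sup>2"
    using Z_le X_le S_le \<mu> by (intro add_mono mult_left_mono power_mono) auto
  \<comment> \<open>By Pythagoras 2 |F|^2 + |g|^2 = 2 |E|^2 - |g|^2, and the cross term uses |g|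
    \<le> |E|. The result is a perfect square.\<close>
  also have "\<dots> \<le> 2 * (frob_norm E)\<^sup>2 + 2 * sqrt 2 * frob_norm E * frob_norm (P * \<Phi>)
      + (frob_norm (P * \<Phi>))\<^sup>2"
  proof -
    have "frob_norm g \<le> 1 * frob_norm E"
      using frob_norm_transpose_isometry_le[OF Q QQ E] by (simp add: g_def)
    also have "\<dots> \<le> sqrt 2 * frob_norm E" by (intro mult_right_mono) auto
    finally have "frob_norm g * frob_norm (P * \<Phi>) \<le> sqrt 2 * frob_norm E * frob_norm (P * \<Phi>)"
      by (intro mult_right_mono) auto
    moreover have "0 \<le> (frob_norm g)\<^sup>2" by simp
    ultimately have "2 * (frob_norm g * frob_norm (P * \<Phi>)) \<le>
        2 * (sqrt 2 * frob_norm E * frob_norm (P * \<Phi>)) + (frob_norm g)\<^sup>2" by linarith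
    then show ?thesis by (simp add: pyth power2_sum algebra_simps)
  qed
  also have "\<dots> = (sqrt 2 * frob_norm E + frob_norm (P * \<Phi>))\<^sup>2"
    by (simp add: power2_sum power_mult_distrib)
  finally show ?thesis
    unfolding \<mu>_def by (rule power2_le_imp_le) simp
qed

section \<open>The deflation residual\<close>

text \<open>Swapping the indices in the second summand turns it into the strictly lower part, so
  only the nonnegative diagonal is lost.\<close>

lemma strict_upper_sum_le:
  fixes f :: "nat \<Rightarrow> nat \<Rightarrow> real"
  assumes "\<And>r c. r < m \<Longrightarrow> c < m \<Longrightarrow> 0 \<le> f r c"
  shows "(\<Sum>r<m. \<Sum>c<m. if r < c then f r c + f c r else 0) \<le> (\<Sum>r<m. \<Sum>c<m. f r c)"
proof -
  have "(\<Sum>r<m. \<Sum>c<m. if r < c then f r c + f c r else 0) =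
      (\<Sum>r<m. \<Sum>c<m. if r < c then f r c else 0) + (\<Sum>r<m. \<Sum>c<m. if r < c then f c r else 0)"
    by (simp flip: sum.distrib add: if_distrib cong: if_cong)
  also have "(\<Sum>r<m. \<Sum>c<m. if r < c then f c r else 0) = (\<Sum>r<m. \<Sum>c<m. if c < r then f r c else 0)"
    by (rule sum.swap)
  also have "(\<Sum>r<m. \<Sum>c<m. if r < c then f r c else 0) + \<dots> =
      (\<Sum>r<m. \<Sum>c<m. (if r < c then f r c else 0) + (if c < r then f r c else 0))"
    by (simp add: sum.distrib)
  also have "\<dots> \<le> (\<Sum>r<m. \<Sum>c<m. f r c)"
    using assms by (intro sum_mono) auto
  finally show ?thesis .
qed

section \<open>Column matrices, their Gram matrices and the gap estimate\<close>

lemma cols_mat_carrier [simp]: "cols_mat n v i \<in> carrier_mat n i"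
  by (simp add: cols_mat_def carrier_matI)

lemma dim_cols_mat [simp]: "dim_row (cols_mat n v i) = n" "dim_col (cols_mat n v i) = i"
  by (simp_all add: cols_mat_def)

lemma cols_mat_index:
  assumes "r < n" "c < i"
  shows "cols_mat n v i $$ (r, c) = v (c + 1) $ r"
  using assms by (simp add: cols_mat_def mat_of_cols_index del: upt_Suc)

lemma gram_cols_mat_index:
  assumes "r < i" "c < i"
  shows "((cols_mat n v i)\<^sup>T * cols_mat n v i) $$ (r, c) = (\<Sum>l<n. v (r + 1) $ l * v (c + 1) $ l)"
  using assms by (subst mult_mat_index[of _ i n _ i]) (auto simp: cols_mat_index)

text \<open>For \<open>i < k\<close>, comparing the entries \<open>(i, k)\<close> and \<open>(k, i)\<close> of the symmetric matrix
  \<open>V\<^sup>T A V = G L + V\<^sup>T E - G \<Phi>\<close> gives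
  \<open>(l k - l i - s i) G\<^sub>i\<^sub>k = K\<^sub>i\<^sub>k + (N \<Phi>)\<^sub>i\<^sub>k\<close> with \<open>K\<close> and \<open>N\<close> as below.\<close>

lemma strict_upper_coupling_le:
  fixes j :: nat and s l :: "nat \<Rightarrow> real"
  defines "m \<equiv> Suc j"
  assumes A: "A \<in> carrier_mat n n" "symmetric_mat A"
    and V: "V \<in> carrier_mat n m" and E: "E \<in> carrier_mat n m"
    and H: "H \<in> carrier_mat j j"
      "\<And>r c. r < j \<Longrightarrow> c < j \<Longrightarrow> r \<noteq> c \<Longrightarrow> H $$ (r, c) = (V\<^sup>T * V) $$ (r, c)"
    and unit: "\<And>i. i < m \<Longrightarrow> (V\<^sup>T * V) $$ (i, i) = 1"
    and res: "A * V + V * \<Phi> = V * mat_diag m l + E"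
    and \<Phi>: "\<Phi> = mat m m (\<lambda>(r, c). if r < c then s r * (V\<^sup>T * V) $$ (r, c) else 0)"
    and "0 < \<gamma>" "0 \<le> \<tau>"
    and gap: "\<And>i k. i < k \<Longrightarrow> k < m \<Longrightarrow> \<gamma> \<le> \<bar>l k - l i - s i\<bar>"
    and shift: "\<And>i. i < j \<Longrightarrow> \<bar>s i\<bar> \<le> \<tau> * \<gamma>"
  shows "(1 - \<tau> * frob_norm H / sqrt 2) * frob_norm \<Phi> \<le> \<tau> * (sqrt 2 * frob_norm (V\<^sup>T * E))"
proof -
  define G where "G = V\<^sup>T * V"
  define B where "B = V\<^sup>T * (A * V)"
  define a where "a = V\<^sup>T * E"
  define K where "K = mat m m (\<lambda>(r, c). if r < c then a $$ (c, r) - a $$ (r, c) else 0)"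
  \<comment> \<open>Row \<open>j\<close> of the strictly upper triangular \<open>\<Phi>\<close> is
    zero, so column \<open>j\<close> of \<open>N\<close> may be cut off. This is what makes the loss
    of only the first \<open>j\<close> vectors enter the constant.\<close>
  define N where "N = mat m m (\<lambda>(r, c). if r < c \<and> c < j then G $$ (r, c) else 0)"
  have VT: "V\<^sup>T \<in> carrier_mat m n" using V by simp
  have AV: "A * V \<in> carrier_mat n m" using A V by simp
  have \<Phi>c: "\<Phi> \<in> carrier_mat m m" by (simp add: \<Phi>)
  have V\<Phi>: "V * \<Phi> \<in> carrier_mat n m" using V \<Phi>c by simp
  have VL: "V * mat_diag m l \<in> carrier_mat n m" using V by (rule mult_carrier_mat) simp
  have c: "G \<in> carrier_mat m m" "B \<in> carrier_mat m m" "a \<in> carrier_mat m m"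
    "K \<in> carrier_mat m m" "N \<in> carrier_mat m m"
    using V A E by (simp_all add: G_def B_def a_def K_def N_def)
  have N\<Phi>: "N * \<Phi> \<in> carrier_mat m m" using c \<Phi>c by simp
  have "G\<^sup>T = G" using transpose_mult[OF VT V] by (simp add: G_def)
  then have Gs: "G $$ (r, q) = G $$ (q, r)" if "r < m" "q < m" for r q
    using c(1) that by (metis carrier_matD index_transpose_mat(1))
  have "B\<^sup>T = B"
    unfolding B_def using transpose_mult[OF VT AV] transpose_mult[OF A(1) V] A V
    by (simp add: symmetric_mat_def assoc_mult_mat[OF VT A(1) V])
  then have Bs: "B $$ (r, q) = B $$ (q, r)" if "r < m" "q < m" for r q
    using c(2) that by (metis carrier_matD index_transpose_mat(1))
  have eq: "B + G * \<Phi> = G * mat_diag m l + a"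
    using arg_cong[OF res, of "\<lambda>Y. V\<^sup>T * Y"] assoc_mult_mat[OF VT V \<Phi>c]
      assoc_mult_mat[OF VT V mat_diag_dim, of l]
    by (simp add: mult_add_distrib_mat[OF VT AV V\<Phi>] mult_add_distrib_mat[OF VT VL E]
      flip: B_def G_def a_def)
  have entry: "B $$ (r, q) + (G * \<Phi>) $$ (r, q) = G $$ (r, q) * l q + a $$ (r, q)"
    if "r < m" "q < m" for r q
    using arg_cong[OF eq, of "\<lambda>Y. Y $$ (r, q)"] that c \<Phi>c
    unfolding mat_diag_mult_right[OF c(1)] by (simp del: index_mult_mat(1))
  have G\<Phi>: "(G * \<Phi>) $$ (r, q) = (\<Sum>t<m. if t < q then s t * G $$ (r, t) * G $$ (t, q) else 0)"
    if "r < m" "q < m" for r q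
    using that by (simp add: mult_mat_index[OF c(1) \<Phi>c] del: index_mult_mat(1))
      (auto simp: \<Phi> G_def[symmetric] intro!: sum.cong)
  have key: "(l k - l i - s i) * G $$ (i, k) = K $$ (i, k) + (N * \<Phi>) $$ (i, k)"
    if ik: "i < k" "k < m" for i k
  proof -
    have im: "i < m" using ik by simp
    \<comment> \<open>The two sums run over t < k and t < i with the same summands, which leaves i
      \<le> t < k. The term t = i is \<open>s i * G $$ (i, k)\<close> because the vectors are unit,
      and the rest is the product with \<open>N\<close>.\<close>
    have "(G * \<Phi>) $$ (i, k) - (G * \<Phi>) $$ (k, i) =
      (\<Sum>t<m. (if t = i then s i * G $$ (i, k) else 0) + N $$ (i, t) * \<Phi> $$ (t, k))"
      unfolding G\<Phi>[OF im ik(2)] G\<Phi>[OF ik(2) im] sum_subtractf[symmetric]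
    proof (rule sum.cong[OF refl])
      fix t assume "t \<in> {..<m}"
      then have t: "t < m" by simp
      show "(if t < k then s t * G $$ (i, t) * G $$ (t, k) else 0)
        - (if t < i then s t * G $$ (k, t) * G $$ (t, i) else 0)
        = (if t = i then s i * G $$ (i, k) else 0) + N $$ (i, t) * \<Phi> $$ (t, k)"
        using ik im t Gs[OF t im] Gs[OF t ik(2)] unit[OF im]
        by (cases t i rule: linorder_cases) (auto simp: N_def \<Phi> m_def simp flip: G_def)
    qed
    also have "\<dots> = s i * G $$ (i, k) + (N * \<Phi>) $$ (i, k)"
      using im ik(2) by (simp add: sum.distrib mult_mat_index[OF c(5) \<Phi>c] del: index_mult_mat(1))
    finally show ?thesis
      using entry[OF im ik(2)] entry[OF ik(2) im] Bs[OF im ik(2)] Gs[OF im ik(2)] ik im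
      by (simp add: K_def algebra_simps del: index_mult_mat(1))
  qed
  \<comment> \<open>Entrywise, |s i| \<le> \<tau> \<gamma>, and \<open>\<gamma>\<close> is absorbed
    by the coefficient of \<open>G $$ (i, k)\<close> in \<open>key\<close>.\<close>
  have "frob_norm \<Phi> \<le> \<tau> * frob_norm (K + N * \<Phi>)"
  proof (rule frob_norm_mono[OF \<Phi>c _ \<open>0 \<le> \<tau>\<close>])
    fix i k assume i: "i < m" and k: "k < m"
    show "\<bar>\<Phi> $$ (i, k)\<bar> \<le> \<tau> * \<bar>(K + N * \<Phi>) $$ (i, k)\<bar>"
    proof (cases "i < k")
      case True
      have "\<bar>\<Phi> $$ (i, k)\<bar> = \<bar>s i\<bar> * \<bar>G $$ (i, k)\<bar>"
        using i k True by (simp add: \<Phi> abs_mult flip: G_def)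
      also have "\<dots> \<le> \<tau> * \<gamma> * \<bar>G $$ (i, k)\<bar>"
        using shift[of i] True k by (intro mult_right_mono) (auto simp: m_def)
      also have "\<dots> \<le> \<tau> * (\<bar>l k - l i - s i\<bar> * \<bar>G $$ (i, k)\<bar>)"
        unfolding mult.assoc using gap[OF True k] \<open>0 \<le> \<tau>\<close> by (intro mult_left_mono mult_right_mono) auto
      also have "\<dots> = \<tau> * \<bar>(K + N * \<Phi>) $$ (i, k)\<bar>"
        using key[OF True k] i k c \<Phi>c by (simp add: abs_mult[symmetric] del: index_mult_mat(1))
      finally show ?thesis .
    next
      case False
      then show ?thesis using i k \<open>0 \<le> \<tau>\<close> by (simp add: \<Phi>)
    qed
  qed (use c N\<Phi> in auto)
  also have "\<dots> \<le> \<tau> * (frob_norm K + frob_norm N * frob_norm \<Phi>)"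
    using frob_norm_triangle[OF c(4) N\<Phi>] frob_norm_mult_le[OF c(5) \<Phi>c] \<open>0 \<le> \<tau>\<close>
    by (intro mult_left_mono) auto
  also have "\<dots> \<le> \<tau> * (sqrt 2 * frob_norm a + frob_norm H / sqrt 2 * frob_norm \<Phi>)"
  proof (intro mult_left_mono add_mono mult_right_mono)
    have "(frob_norm K)\<^sup>2 = (\<Sum>r<m. \<Sum>q<m. if r < q then (a $$ (q, r) - a $$ (r, q))\<^sup>2 else 0)"
      by (auto simp: K_def frob_norm_def sum_nonneg intro!: sum.cong)
    also have "\<dots> \<le> (\<Sum>r<m. \<Sum>q<m. if r < q then 2 * (a $$ (r, q))\<^sup>2 + 2 * (a $$ (q, r))\<^sup>2 else 0)"
    proof (intro sum_mono)
      fix r q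
      have "(a $$ (q, r) - a $$ (r, q))\<^sup>2 \<le> 2 * (a $$ (r, q))\<^sup>2 + 2 * (a $$ (q, r))\<^sup>2"
        using zero_le_power2[of "a $$ (q, r) + a $$ (r, q)"] by (simp add: power2_sum power2_diff)
      then show "(if r < q then (a $$ (q, r) - a $$ (r, q))\<^sup>2 else 0)
        \<le> (if r < q then 2 * (a $$ (r, q))\<^sup>2 + 2 * (a $$ (q, r))\<^sup>2 else 0)" by simp
    qed
    also have "\<dots> \<le> (\<Sum>r<m. \<Sum>q<m. 2 * (a $$ (r, q))\<^sup>2)"
      by (rule strict_upper_sum_le) simp
    also have "\<dots> = (sqrt 2 * frob_norm a)\<^sup>2"
      using c by (simp add: frob_norm_def sum_nonneg power_mult_distrib sum_distrib_left)
    finally show "frob_norm K \<le> sqrt 2 * frob_norm a"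
      by (rule power2_le_imp_le) simp
    \<comment> \<open>By symmetry of \<open>G\<close> each entry of \<open>N\<close> occurs twice in
      \<open>H\<close>, which gives the factor 1 / sqrt 2 in the constant.\<close>
    have "2 * (frob_norm N)\<^sup>2 = (\<Sum>r<j. \<Sum>q<j. if r < q then 2 * (G $$ (r, q))\<^sup>2 else 0)"
      by (auto simp: N_def frob_norm_def sum_nonneg m_def sum_distrib_left intro!: sum.cong)
    also have "\<dots> = (\<Sum>r<j. \<Sum>q<j. if r < q then (H $$ (r, q))\<^sup>2 + (H $$ (q, r))\<^sup>2 else 0)"
      using H(2) Gs by (intro sum.cong refl) (auto simp: m_def simp flip: G_def)
    also have "\<dots> \<le> (\<Sum>r<j. \<Sum>q<j. (H $$ (r, q))\<^sup>2)"
      by (rule strict_upper_sum_le) simp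
    also have "\<dots> = (frob_norm H)\<^sup>2"
      using H(1) by (simp add: frob_norm_def sum_nonneg)
    finally have "(frob_norm N)\<^sup>2 \<le> (frob_norm H / sqrt 2)\<^sup>2" by (simp add: power_divide)
    then show "frob_norm N \<le> frob_norm H / sqrt 2"
      by (rule power2_le_imp_le) simp
  qed (use \<open>0 \<le> \<tau>\<close> in auto)
  finally show ?thesis by (simp add: a_def algebra_simps)
qed

text \<open>Stacks the steps as columns. Column \<open>i\<close>, counted from 0, comes from step
  \<open>i\<close>, whose deflation term is the sum over k \<le> i of \<sigma>(k) <v(k), v(i+1)>
  v(k); only earlier vectors occur, hence the strict triangle.\<close>

lemma deflated_residual:
  assumes A: "A \<in> carrier_mat n n"
    and v: "\<And>i. i \<in> {1..m} \<Longrightarrow> v i \<in> carrier_vec n"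
    and \<eta>: "\<And>i. i \<in> {1..m} \<Longrightarrow> \<eta> i \<in> carrier_vec n"
    and step: "\<And>i. i < m \<Longrightarrow>
      deflated A \<sigma> v i *\<^sub>v v (i + 1) = lam (i + 1) \<cdot>\<^sub>v v (i + 1) + \<eta> (i + 1)"
  defines "V \<equiv> cols_mat n v m"
  defines "\<Phi> \<equiv> mat m m (\<lambda>(r, c). if r < c then \<sigma> (r + 1) * (V\<^sup>T * V) $$ (r, c) else 0)"
  shows "A * V + V * \<Phi> = V * eigval_mat lam m + cols_mat n \<eta> m"
proof (rule eq_matI)
  have V: "V \<in> carrier_mat n m" by (simp add: V_def)
  have \<Phi>: "\<Phi> \<in> carrier_mat m m" by (simp add: \<Phi>_def)
  have diag: "V * eigval_mat lam m = mat n m (\<lambda>(r, c). V $$ (r, c) * lam (c + 1))"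
    unfolding eigval_mat_def using V by (rule mat_diag_mult_right)
  fix r i
  assume "r < dim_row (V * eigval_mat lam m + cols_mat n \<eta> m)"
    "i < dim_col (V * eigval_mat lam m + cols_mat n \<eta> m)"
  then have r: "r < n" and i: "i < m"
    using cols_mat_carrier[of n \<eta> m] by auto
  have vd: "dim_vec (v (k + 1)) = n" "dim_vec (\<eta> (k + 1)) = n" if "k < m" for k
    using v[of "k + 1"] \<eta>[of "k + 1"] that by auto
  have "(A * V) $$ (r, i) = (\<Sum>t<n. A $$ (r, t) * v (i + 1) $ t)"
    using r i by (simp add: mult_mat_index[OF A V] del: index_mult_mat(1))
      (simp add: V_def cols_mat_index)
  moreover have "(V * \<Phi>) $$ (r, i) = (\<Sum>t<n. (\<Sum>k=1..i. \<sigma> k * (v k $ r * v k $ t)) * v (i + 1) $ t)"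
  proof -
    have "(V * \<Phi>) $$ (r, i) = (\<Sum>k<m. if k < i then v (k + 1) $ r * (\<sigma> (k + 1) *
        (\<Sum>t<n. v (k + 1) $ t * v (i + 1) $ t)) else 0)"
      using r i by (simp add: mult_mat_index[OF V \<Phi>] del: index_mult_mat(1))
        (auto simp: \<Phi>_def V_def gram_cols_mat_index cols_mat_index simp del: index_mult_mat(1)
          intro!: sum.cong)
    also have "\<dots> = (\<Sum>k<i. v (k + 1) $ r * (\<sigma> (k + 1) * (\<Sum>t<n. v (k + 1) $ t * v (i + 1) $ t)))"
      using i by (intro sum.mono_neutral_cong_right) auto
    also have "\<dots> = (\<Sum>k=1..i. v k $ r * (\<sigma> k * (\<Sum>t<n. v k $ t * v (i + 1) $ t)))"
      by (rule sum.reindex_bij_witness[of _ "\<lambda>k. k - 1" Suc]) auto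
    also have "\<dots> = (\<Sum>k=1..i. \<Sum>t<n. \<sigma> k * (v k $ r * v k $ t) * v (i + 1) $ t)"
      by (simp add: sum_distrib_left mult_ac)
    also have "\<dots> = (\<Sum>t<n. \<Sum>k=1..i. \<sigma> k * (v k $ r * v k $ t) * v (i + 1) $ t)"
      by (rule sum.swap)
    finally show ?thesis by (simp add: sum_distrib_right)
  qed
  moreover have "(deflated A \<sigma> v i *\<^sub>v v (i + 1)) $ r
    = (\<Sum>t<n. (A $$ (r, t) + (\<Sum>k=1..i. \<sigma> k * (v k $ r * v k $ t))) * v (i + 1) $ t)"
  proof -
    have "deflated A \<sigma> v i $$ (r, t) = A $$ (r, t) + (\<Sum>k=1..i. \<sigma> k * (v k $ r * v k $ t))"
      if "t < n" for t
    proof -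
      have "(\<sigma> k \<cdot>\<^sub>m outer_prod (v k) (v k)) $$ (r, t) = \<sigma> k * (v k $ r * v k $ t)"
        if "k \<in> {1..i}" for k
        using v[of k] that i r \<open>t < n\<close> by (auto simp: outer_prod_def)
      then show ?thesis using A r that by (simp add: deflated_def)
    qed
    moreover have "deflated A \<sigma> v i \<in> carrier_mat n n" using A by (simp add: deflated_def)
    ultimately show ?thesis
      using r vd(1)[OF i] by (simp add: scalar_prod_def atLeast0LessThan)
  qed
  ultimately have "(A * V) $$ (r, i) + (V * \<Phi>) $$ (r, i) = (deflated A \<sigma> v i *\<^sub>v v (i + 1)) $ r"
    by (simp add: sum.distrib algebra_simps)
  also have "\<dots> = lam (i + 1) * v (i + 1) $ r + \<eta> (i + 1) $ r"
    using step[OF i] vd[OF i] r by simp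
  finally show "(A * V + V * \<Phi>) $$ (r, i) = (V * eigval_mat lam m + cols_mat n \<eta> m) $$ (r, i)"
    unfolding diag using r i A V \<Phi> cols_mat_carrier[of n \<eta> m]
    by (simp add: cols_mat_index V_def del: index_mult_mat(1))
qed (use A in \<open>auto simp: V_def \<Phi>_def eigval_mat_def cols_mat_def mat_diag_def\<close>)

lemma spectral_gap_le:
  assumes "i \<in> {1..j}" "k \<in> {1..j+1}"
  shows "spectral_gap lam \<sigma> j \<le> \<bar>lam k - lam i - \<sigma> i\<bar>"
proof -
  let ?S = "{\<bar>x - \<theta>\<bar> | x \<theta>. x \<in> lam ` {1..j+1} \<and> \<theta> \<in> (\<lambda>i. lam i + \<sigma> i) ` {1..j}}"
  \<comment> \<open>An image of a finite product, which shows that the minimum is over a finite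
    set.\<close>
  have "?S = (\<lambda>(x, \<theta>). \<bar>x - \<theta>\<bar>) ` (lam ` {1..j+1} \<times> (\<lambda>i. lam i + \<sigma> i) ` {1..j})"
    by auto
  then have "finite ?S" by simp
  moreover have "\<bar>lam k - (lam i + \<sigma> i)\<bar> \<in> ?S" using assms by blast
  ultimately have "Min ?S \<le> \<bar>lam k - (lam i + \<sigma> i)\<bar>" by (rule Min_le)
  then show ?thesis by (simp add: spectral_gap_def algebra_simps)
qed

text \<open>The gap cancels: \<tau> \<gamma> is the largest absolute shift.\<close>

lemma abs_shift_le:
  assumes "i \<in> {1..j}" "0 < spectral_gap lam \<sigma> j"
  shows "\<bar>\<sigma> i\<bar> \<le> shift_gap_ratio lam \<sigma> j * spectral_gap lam \<sigma> j"
  using assms by (auto simp: shift_gap_ratio_def intro: Max_ge)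

section \<open>The backward error bound for the deflation procedure\<close>

theorem theorem3p3:
  fixes n j :: nat
    and A Q P :: "real mat"
    and \<sigma> lam :: "nat \<Rightarrow> real"
    and v \<eta> :: "nat \<Rightarrow> real vec"
    and \<gamma> \<tau> c \<delta> :: real
    and \<omega> :: "nat \<Rightarrow> real"
  assumes "j \<ge> 1"
    and "A \<in> carrier_mat n n" and "symmetric_mat A"
    and "\<And>i. i \<in> {1..j+1} \<Longrightarrow> v i \<in> carrier_vec n \<and> vec_norm2 (v i) = 1"
    and "\<And>i. i \<in> {1..j+1} \<Longrightarrow> \<eta> i \<in> carrier_vec n"
    and "\<And>i. i \<in> {0..j} \<Longrightarrow>
           deflated A \<sigma> v i *\<^sub>v v (i+1) = lam (i+1) \<cdot>\<^sub>v v (i+1) + \<eta> (i+1)"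
    and "polar_decomposition (cols_mat n v (j+1)) Q P"
  defines "\<gamma> \<equiv> spectral_gap lam \<sigma> j"
    and "\<tau> \<equiv> shift_gap_ratio lam \<sigma> j"
    and "\<omega> \<equiv> orth_loss n v"
    and "\<delta> \<equiv> sym_backward_error A Q (eigval_mat lam (j+1))"
    and "c \<equiv> inverse (1 - \<tau> * \<omega> j / sqrt 2)"
  assumes "\<gamma> > 0"
    and "\<tau> * \<omega> j < sqrt 2"
    and "\<omega> (j+1) < 1"
  shows "\<delta> \<le> sqrt 2 * ((1 + c * \<tau> * (1 + \<omega> (j+1))) / sqrt (1 - \<omega> (j+1)))
               * frob_norm (cols_mat n \<eta> (j+1))"
proof -
  define m where "m = Suc j"
  define V where "V = cols_mat n v m"
  define E where "E = cols_mat n \<eta> m"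
  define \<Phi> where "\<Phi> = mat m m (\<lambda>(r, c). if r < c then \<sigma> (r + 1) * (V\<^sup>T * V) $$ (r, c) else 0)"
  define w where "w = \<omega> m"
  have m: "j + 1 = m" by (simp add: m_def)
  have V: "V \<in> carrier_mat n m" and E: "E \<in> carrier_mat n m" and \<Phi>: "\<Phi> \<in> carrier_mat m m"
    by (simp_all add: V_def E_def \<Phi>_def)
  have polar: "polar_decomposition V Q P" using assms(7) by (simp add: V_def m_def)
  have Q: "Q \<in> carrier_mat n m" and P: "P \<in> carrier_mat m m" "symmetric_mat P"
    and QQ: "Q\<^sup>T * Q = 1\<^sub>m m"
    using polar V by (auto simp: polar_decomposition_def psd_mat_def)
  have w_eq: "w = frob_norm (V\<^sup>T * V - 1\<^sub>m m)"
    by (simp add: w_def assms orth_loss_def V_def)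
  have w: "w < 1" using assms(15) by (simp add: w_def m_def)
  have w0: "0 \<le> w" by (simp add: w_eq)
  have res: "A * V + V * \<Phi> = V * eigval_mat lam m + E"
    unfolding V_def \<Phi>_def E_def using assms(2,4,5,6) by (intro deflated_residual) (auto simp: m_def)
  have "1 \<in> {1..j}" using assms(1) by simp
  then have \<tau>: "0 \<le> \<tau>"
    using abs_shift_le[of 1 j lam \<sigma>] assms(13) unfolding \<gamma>_def \<tau>_def
    by (smt (verit) zero_le_mult_iff)
  \<comment> \<open>The coefficient of |\<Phi>| in the coupling estimate; being positive it can be
    divided out, and its reciprocal is \<open>c\<close>.\<close>
  have den: "0 < 1 - \<tau> * \<omega> j / sqrt 2" using assms(14) by simp
  then have cpos: "0 < c" by (simp add: assms(12))

  have mult_P_le: "frob_norm (P * X) \<le> sqrt (1 + w) * frob_norm X" if "X \<in> carrier_mat m k" for X k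
  proof (rule power2_le_imp_le)
    show "(frob_norm (P * X))\<^sup>2 \<le> (sqrt (1 + w) * frob_norm X)\<^sup>2"
      using frob_norm_sqrt_mult_bounds(2)[OF P that] w0
      by (simp add: w_eq polar_gram(1)[OF polar V] power_mult_distrib)
  qed (use w0 in simp)
  have "frob_norm (V\<^sup>T * E) = frob_norm (P * (Q\<^sup>T * E))"
    using Q E P by (simp add: polar_gram(2)[OF polar V] assoc_mult_mat[of P m m _ n E m])
  also have "\<dots> \<le> sqrt (1 + w) * frob_norm (Q\<^sup>T * E)"
    using Q E by (intro mult_P_le[of _ m]) simp
  also have "\<dots> \<le> sqrt (1 + w) * frob_norm E"
    using frob_norm_transpose_isometry_le[OF Q QQ E] w0 by (intro mult_left_mono) auto
  finally have VE: "frob_norm (V\<^sup>T * E) \<le> sqrt (1 + w) * frob_norm E" .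

  \<comment> \<open>The coupling lemma counts from 0, hence the shifted index \<open>i + 1\<close>.
    Its \<open>H\<close> is the loss matrix of the first \<open>j\<close> vectors, which agrees off
    the diagonal with the leading block of \<open>V\<^sup>T * V\<close>.\<close>
  have "(1 - \<tau> * \<omega> j / sqrt 2) * frob_norm \<Phi> \<le> \<tau> * (sqrt 2 * frob_norm (V\<^sup>T * E))"
    unfolding \<omega>_def orth_loss_def
  proof (rule strict_upper_coupling_le[where j = j and s = "\<lambda>i. \<sigma> (i + 1)" and l = "\<lambda>k. lam (k + 1)",
        OF assms(2,3), folded m_def])
    show "A * V + V * \<Phi> = V * mat_diag m (\<lambda>k. lam (k + 1)) + E"
      using res by (simp add: eigval_mat_def)
    show "\<Phi> = mat m m (\<lambda>(r, c). if r < c then \<sigma> (r + 1) * (V\<^sup>T * V) $$ (r, c) else 0)"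
      by (rule \<Phi>_def)
    show "(V\<^sup>T * V) $$ (i, i) = 1" if "i < m" for i
      using assms(4)[of "i + 1"] that unfolding V_def
      by (subst gram_cols_mat_index) (auto simp: vec_norm2_def m_def power2_eq_square)
    show "((cols_mat n v j)\<^sup>T * cols_mat n v j - 1\<^sub>m j) $$ (r, q) = (V\<^sup>T * V) $$ (r, q)"
      if "r < j" "q < j" "r \<noteq> q" for r q
      using that gram_cols_mat_index[of r j q n v] gram_cols_mat_index[of r m q n v]
        cols_mat_carrier[of n v j] by (simp add: V_def m_def del: index_mult_mat(1))
    show "\<gamma> \<le> \<bar>lam (k + 1) - lam (i + 1) - \<sigma> (i + 1)\<bar>" if "i < k" "k < m" for i k
      unfolding \<gamma>_def using that by (intro spectral_gap_le) (auto simp: m_def)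
    show "\<bar>\<sigma> (i + 1)\<bar> \<le> \<tau> * \<gamma>" if "i < j" for i
      using abs_shift_le[of "i + 1" j lam \<sigma>] that assms(13) by (simp add: \<tau>_def \<gamma>_def)
  qed (use V E \<tau> assms(13) in \<open>auto intro: minus_carrier_mat\<close>)
  also have "\<dots> \<le> \<tau> * (sqrt 2 * (sqrt (1 + w) * frob_norm E))"
    using VE \<tau> by (intro mult_left_mono) auto
  finally have "frob_norm \<Phi> \<le> \<tau> * (sqrt 2 * (sqrt (1 + w) * frob_norm E)) / (1 - \<tau> * \<omega> j / sqrt 2)"
    unfolding pos_le_divide_eq[OF den] by (simp only: mult.commute)
  then have \<Phi>_le: "frob_norm \<Phi> \<le> c * \<tau> * (sqrt 2 * (sqrt (1 + w) * frob_norm E))"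
    by (simp only: assms(12) divide_inverse mult_ac)
  \<comment> \<open>\<open>P\<close> contributes a second factor sqrt (1 + w); with the one from
    \<open>VE\<close> it yields the 1 + \<omega> of the claim.\<close>
  have "frob_norm (P * \<Phi>) \<le> sqrt (1 + w) * (c * \<tau> * (sqrt 2 * (sqrt (1 + w) * frob_norm E)))"
    using mult_P_le[OF \<Phi>] \<Phi>_le w0 by (meson mult_left_mono order_trans real_sqrt_ge_zero add_nonneg_nonneg zero_le_one)
  also have "\<dots> = sqrt 2 * (c * \<tau> * (sqrt (1 + w) * sqrt (1 + w))) * frob_norm E"
    by (simp only: mult_ac)
  also have "sqrt (1 + w) * sqrt (1 + w) = 1 + w"
    using w0 by simp
  finally have P\<Phi>: "frob_norm (P * \<Phi>) \<le> sqrt 2 * (c * \<tau> * (1 + w)) * frob_norm E" .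
  have "sqrt (1 - w) * \<delta> \<le> sqrt 2 * frob_norm E + frob_norm (P * \<Phi>)"
    unfolding w_eq \<delta>_def m using assms(2,3) V polar _ _ E \<Phi> res
  proof (rule sym_backward_error_polar_le)
    show "symmetric_mat (eigval_mat lam m)"
      by (auto simp: symmetric_mat_def eigval_mat_def mat_diag_def)
  qed (use w in \<open>simp_all add: w_eq eigval_mat_def\<close>)
  also note P\<Phi>
  finally have "sqrt (1 - w) * \<delta> \<le> sqrt 2 * (1 + c * \<tau> * (1 + w)) * frob_norm E"
    by (simp add: algebra_simps)
  then have "\<delta> \<le> sqrt 2 * (1 + c * \<tau> * (1 + w)) * frob_norm E / sqrt (1 - w)"
    using w by (simp add: pos_le_divide_eq mult.commute)
  then show ?thesis
    unfolding m w_def[symmetric] E_def[symmetric] by simp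
qed

end
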